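(* Suppose that $\{\mathbb G(t)\}_{t\ge0}$ is uniformly strongly connected. Then the sequence of stochastic matrices $\{S(t)\}_{t\ge0}$ has a unique absolute probability sequence $\{\pi(t)\}_{t\ge0}$, and it is given by $\pi_i(t)=\frac{y_i(t)}{n}$ for all $i\in\mathcal V$ and $t\ge0$.
   Context: There are $n$ agents, $\mathcal V=\{1,\dots,n\}$. For each integer $t\ge0$, $\mathbb G(t)=(\mathcal V,\mathcal E(t))$ is a directed graph with self-arcs at all vertices. $\mathcal N_i(t)=\{j:(j,i)\in\mathcal E(t)\}$ and $\mathcal N_i^-(t)=\{k:(i,k)\in\mathcal E(t)\}$. The weights satisfy: there is a constant $\beta>0$ such that $w_{ij}(t)\ge\beta$ for all $i,t$ and $j\in\mathcal N_i(t)$; $w_{ij}(t)=0$ if $j\notin\mathcal N_i(t)$; and $\sum_{j\in\mathcal N_i^-(t)}w_{ji}(t)=1$ for all $i,t$. $\{\mathbb G(t)\}$ is uniformly strongly connected if there is a positive integer $L$ such that for every $t\ge0$ the union graph $\cup_{k=t}^{t+L-1}\mathbb G(k)$ (vertex set $\mathcal V$, union of the edge sets) is strongly connected. The numbers $y_i(t)$ are defined by $y_i(0)=1$ and $y_i(t+1)=\sum_{j=1}^n w_{ij}(t)y_j(t)$. $S(t)$ is the $n\times n$ matrix with entries $$s_{ij}(t)=\frac{w_{ij}(t)y_j(t)}{y_i(t+1)}=\frac{w_{ij}(t)y_j(t)}{\sum_{k=1}^n w_{ik}(t)y_k(t)};$$ it is a (row) stochastic matrix. A stochastic vector is a nonnegative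 vector whose entries sum to one. A sequence of stochastic vectors $\{\pi(t)\}$ is an absolute probability sequence for a sequence of stochastic matrices $\{S(t)\}$ if $\pi^\top(t)=\pi^\top(t+1)S(t)$ for all $t\ge0$. *)

theory Defs
  imports "HOL-Analysis.Analysis" "Graph_Theory.Digraph_Component"
begin

definition in_neighbors :: "'a pair_pre_digraph \<Rightarrow> 'a \<Rightarrow> 'a set" where
  "in_neighbors G i = {j. (j, i) \<in> parcs G}"

definition out_neighbors :: "'a pair_pre_digraph \<Rightarrow> 'a \<Rightarrow> 'a set" where
  "out_neighbors G i = {k. (i, k) \<in> parcs G}"

text \<open>
  The library's \<^const>\<open>pre_digraph.Union\<close> takes its tail and head maps from an extra graph
  argument. The maps are \<^const>\<open>fst\<close> and \<^const>\<open>snd\<close> for every graph in the sequence,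
  so the choice \<open>\<G> t\<close> is immaterial.
\<close>

definition uniformly_strongly_connected :: "(nat \<Rightarrow> 'a pair_pre_digraph) \<Rightarrow> bool" where
  "uniformly_strongly_connected \<G> \<longleftrightarrow>
     (\<exists>L>0. \<forall>t. strongly_connected
        (pre_digraph.Union (with_proj (\<G> t)) ((\<lambda>k. with_proj (\<G> k)) ` {t..t + L - 1})))"

primrec push_sum_weight :: "(nat \<Rightarrow> real^'n^'n) \<Rightarrow> nat \<Rightarrow> real^'n" where
  "push_sum_weight W 0 = (\<chi> i. 1)"
| "push_sum_weight W (Suc t) = (\<chi> i. \<Sum>j\<in>UNIV. W t $ i $ j * push_sum_weight W t $ j)"

definition push_sum_matrix :: "(nat \<Rightarrow> real^'n^'n) \<Rightarrow> nat \<Rightarrow> real^'n^'n" where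
  "push_sum_matrix W t =
     (\<chi> i j. W t $ i $ j * push_sum_weight W t $ j / push_sum_weight W (Suc t) $ i)"

definition stochastic_vector :: "real^'n \<Rightarrow> bool" where
  "stochastic_vector p \<longleftrightarrow> (\<forall>i. 0 \<le> p $ i) \<and> (\<Sum>i\<in>UNIV. p $ i) = 1"

definition stochastic_matrix :: "real^'n^'m \<Rightarrow> bool" where
  "stochastic_matrix A \<longleftrightarrow> (\<forall>i. stochastic_vector (A $ i))"

definition absolute_probability_sequence ::
    "(nat \<Rightarrow> real^'n^'n) \<Rightarrow> (nat \<Rightarrow> real^'n) \<Rightarrow> bool" where
  "absolute_probability_sequence S p \<longleftrightarrow>
     (\<forall>t. stochastic_vector (p t)) \<and> (\<forall>t. p t = p (Suc t) v* S t)"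

lemma push_sum_weight_pos:
  fixes W :: "nat \<Rightarrow> real^'n^'n"
  assumes nonneg: "\<And>t i j. 0 \<le> W t $ i $ j" and diag: "\<And>t i. 0 < W t $ i $ i"
  shows "0 < push_sum_weight W t $ i"
proof (induction t arbitrary: i)
  case 0
  then show ?case by simp
next
  case (Suc t)
  have "0 < (\<Sum>j\<in>UNIV. W t $ i $ j * push_sum_weight W t $ j)"
  proof (rule sum_pos2[of UNIV i])
    show "0 < W t $ i $ i * push_sum_weight W t $ i"
      using diag Suc by simp
    show "0 \<le> W t $ i $ j * push_sum_weight W t $ j" for j
      using nonneg less_imp_le[OF Suc] by simp
  qed simp_all
  then show ?case by simp
qed

lemma stochastic_push_sum_matrix:
  fixes W :: "nat \<Rightarrow> real^'n^'n" and \<G> :: "nat \<Rightarrow> 'n pair_pre_digraph"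
  assumes self_arcs: "\<And>t i. (i, i) \<in> parcs (\<G> t)"
    and "0 < \<beta>"
    and weight_ge: "\<And>t i j. j \<in> in_neighbors (\<G> t) i \<Longrightarrow> \<beta> \<le> W t $ i $ j"
    and weight_zero: "\<And>t i j. j \<notin> in_neighbors (\<G> t) i \<Longrightarrow> W t $ i $ j = 0"
  shows "stochastic_matrix (push_sum_matrix W t)"
proof -
  have nonneg: "0 \<le> W t $ i $ j" for t i j
    using weight_ge[where t = t and i = i and j = j] weight_zero[where t = t and i = i and j = j] \<open>0 < \<beta>\<close>
    by (cases "j \<in> in_neighbors (\<G> t) i") auto
  have diag: "0 < W t $ i $ i" for t i
    using weight_ge[where t = t and i = i and j = i] self_arcs[where t = t and i = i] \<open>0 < \<beta>\<close>
    by (auto simp: in_neighbors_def)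
  note pos = push_sum_weight_pos[of W, OF nonneg diag]
  show ?thesis
    unfolding stochastic_matrix_def stochastic_vector_def
  proof (intro allI conjI)
    fix i j
    show "0 \<le> push_sum_matrix W t $ i $ j"
      using nonneg[of t i j] pos[of t j] pos[of "Suc t" i]
      by (simp add: push_sum_matrix_def del: push_sum_weight.simps)
  next
    fix i
    have "(\<Sum>j\<in>UNIV. push_sum_matrix W t $ i $ j)
        = (\<Sum>j\<in>UNIV. W t $ i $ j * push_sum_weight W t $ j) / push_sum_weight W (Suc t) $ i"
      by (simp add: push_sum_matrix_def sum_divide_distrib del: push_sum_weight.simps)
    also have "\<dots> = push_sum_weight W (Suc t) $ i / push_sum_weight W (Suc t) $ i"
      by simp
    also have "\<dots> = 1"
      using pos[of "Suc t" i] by (simp del: push_sum_weight.simps)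
    finally show "(\<Sum>j\<in>UNIV. push_sum_matrix W t $ i $ j) = 1" .
  qed
qed

end

theory Submission
  imports Defs
begin

text \<open>
  Write \<open>y(t)\<close> for the push-sum weights and \<open>W(t)\<close>, \<open>S(t)\<close> for the two matrices. The columns of
  \<open>W(t)\<close> sum to one, so the total mass of \<open>y\<close> stays equal to \<open>n\<close>. In the sum
  \<open>\<Sum>\<^sub>i y\<^sub>i(t+1) s\<^sub>i\<^sub>j(t)\<close> the denominators of \<open>S(t)\<close> cancel and leave \<open>y\<^sub>j(t)\<close> times a column sum,
  so \<open>y/n\<close> is an absolute probability sequence.

  Uniqueness is a Doeblin argument run backwards in time. An absolute probability sequence satisfies
  \<open>\<pi>(t) = \<pi>(t+T) P\<close> with \<open>P = S(t+T-1) \<dots> S(t)\<close>. If every row of \<open>P\<close> dominates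
  \<open>\<eta> \<nu>\<close> for one and the same vector \<open>\<nu>\<close> with entries summing to one, then multiplication by \<open>P\<close>
  contracts the \<open>\<ell>\<^sup>1\<close> norm by \<open>1 - \<eta>\<close> on vectors with entries summing to zero
  (\<open>l1_norm_contraction\<close>). The difference of two absolute probability sequences is such a vector, and
  its \<open>\<ell>\<^sup>1\<close> norm is at most \<open>2\<close> at every time. Going \<open>m\<close> windows into the future therefore bounds it
  at time \<open>t\<close> by \<open>2 (1 - \<eta>)\<^sup>m\<close> for every \<open>m\<close>, so it vanishes
  (\<open>absolute_probability_sequence_unique\<close>).

  The minorization comes from two facts. Along a path of arcs at the times \<open>t, \<dots>, t+T-1\<close>, from \<open>i\<close>
  to \<open>k\<close>, the entries of \<open>S\<close> telescope and give
  \<open>P\<^sub>k\<^sub>i \<ge> \<beta>\<^sup>T y\<^sub>i(t) / y\<^sub>k(t+T) \<ge> \<beta>\<^sup>T (y\<^sub>i(t) / n)\<close> (\<open>window_product_ge\<close>), the last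
  step because the total mass \<open>n\<close> bounds every weight; hence \<open>\<nu> = y(t)/n\<close> and \<open>\<eta> = \<beta>\<^sup>T\<close> will do.
  And such a path exists between all
  pairs of vertices when \<open>T = L n\<close>, since the set of vertices reached from \<open>i\<close> never shrinks and
  gains a vertex in every \<open>L\<close> steps until it is everything (\<open>reached_eq_UNIV\<close>).
\<close>

section \<open>Uniqueness of absolute probability sequences under minorization\<close>

primrec window_product :: "(nat \<Rightarrow> real^'n^'n) \<Rightarrow> nat \<Rightarrow> nat \<Rightarrow> real^'n^'n" where
  "window_product S t 0 = mat 1"
| "window_product S t (Suc m) = S (t + m) ** window_product S t m"

lemma stochastic_matrix_mat_1: "stochastic_matrix (mat 1)"
  by (simp add: stochastic_matrix_def stochastic_vector_def mat_def)

lemma stochastic_matrix_mult: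
  fixes A B :: "real^'n^'n"
  assumes "stochastic_matrix A" and "stochastic_matrix B"
  shows "stochastic_matrix (A ** B)"
  unfolding stochastic_matrix_def stochastic_vector_def
proof (intro allI conjI)
  fix i j
  show "0 \<le> (A ** B) $ i $ j"
    using assms
    by (auto simp: matrix_matrix_mult_def stochastic_matrix_def stochastic_vector_def intro!: sum_nonneg)
next
  fix i
  have "(\<Sum>j\<in>UNIV. (A ** B) $ i $ j) = (\<Sum>k\<in>UNIV. \<Sum>j\<in>UNIV. A $ i $ k * B $ k $ j)"
    unfolding matrix_matrix_mult_def by (simp add: sum.swap[of "\<lambda>j k. A $ i $ k * B $ k $ j"])
  also have "\<dots> = (\<Sum>k\<in>UNIV. A $ i $ k * (\<Sum>j\<in>UNIV. B $ k $ j))"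
    by (simp add: sum_distrib_left)
  also have "\<dots> = 1"
    using assms by (simp add: stochastic_matrix_def stochastic_vector_def)
  finally show "(\<Sum>j\<in>UNIV. (A ** B) $ i $ j) = 1" .
qed

lemma stochastic_window_product:
  assumes "\<And>t. stochastic_matrix (S t)"
  shows "stochastic_matrix (window_product S t m)"
  by (induction m) (simp_all add: stochastic_matrix_mat_1 stochastic_matrix_mult assms)

lemma absolute_probability_sequence_window:
  assumes "absolute_probability_sequence S p"
  shows "p t = p (t + m) v* window_product S t m"
proof (induction m)
  case 0
  then show ?case by simp
next
  case (Suc m)
  have "p (t + m) = p (t + Suc m) v* S (t + m)"
    using assms unfolding absolute_probability_sequence_def by (metis add_Suc_right)
  then show ?case
    unfolding Suc by (simp add: vector_matrix_mul_assoc)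
qed

text \<open>
  Since the entries of \<open>e\<close> sum to zero, subtracting the same vector \<open>c \<nu>\<close> from every row of \<open>A\<close> does
  not change \<open>e v* A\<close>. It leaves a nonnegative matrix with row sums \<open>1 - c\<close>.
\<close>

lemma l1_norm_contraction:
  fixes e \<nu> :: "real^'n" and A :: "real^'n^'n"
  assumes A: "stochastic_matrix A"
    and minor: "\<And>k i. c * \<nu> $ i \<le> A $ k $ i"
    and \<nu>: "(\<Sum>i\<in>UNIV. \<nu> $ i) = 1"
    and e: "(\<Sum>k\<in>UNIV. e $ k) = 0"
  shows "(\<Sum>i\<in>UNIV. \<bar>(e v* A) $ i\<bar>) \<le> (1 - c) * (\<Sum>k\<in>UNIV. \<bar>e $ k\<bar>)"
proof -
  have shift: "(e v* A) $ i = (\<Sum>k\<in>UNIV. e $ k * (A $ k $ i - c * \<nu> $ i))" for i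
  proof -
    have "(\<Sum>k\<in>UNIV. e $ k * (A $ k $ i - c * \<nu> $ i))
        = (\<Sum>k\<in>UNIV. e $ k * A $ k $ i) - (\<Sum>k\<in>UNIV. e $ k) * (c * \<nu> $ i)"
      by (simp add: right_diff_distrib sum_subtractf sum_distrib_right)
    then show ?thesis
      by (simp add: e vector_matrix_mult_def mult.commute)
  qed
  have "(\<Sum>i\<in>UNIV. \<bar>(e v* A) $ i\<bar>)
      \<le> (\<Sum>i\<in>UNIV. \<Sum>k\<in>UNIV. \<bar>e $ k\<bar> * (A $ k $ i - c * \<nu> $ i))"
  proof (rule sum_mono)
    fix i
    have "\<bar>(e v* A) $ i\<bar> \<le> (\<Sum>k\<in>UNIV. \<bar>e $ k * (A $ k $ i - c * \<nu> $ i)\<bar>)"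
      unfolding shift by (rule sum_abs)
    then show "\<bar>(e v* A) $ i\<bar> \<le> (\<Sum>k\<in>UNIV. \<bar>e $ k\<bar> * (A $ k $ i - c * \<nu> $ i))"
      using minor by (simp add: abs_mult)
  qed
  also have "\<dots> = (\<Sum>k\<in>UNIV. \<Sum>i\<in>UNIV. \<bar>e $ k\<bar> * (A $ k $ i - c * \<nu> $ i))"
    by (rule sum.swap)
  also have "\<dots> = (\<Sum>k\<in>UNIV. \<bar>e $ k\<bar> * ((\<Sum>i\<in>UNIV. A $ k $ i) - c * (\<Sum>i\<in>UNIV. \<nu> $ i)))"
    by (simp add: sum_distrib_left[symmetric] sum_subtractf)
  also have "\<dots> = (1 - c) * (\<Sum>k\<in>UNIV. \<bar>e $ k\<bar>)"
    using A by (simp add: \<nu> stochastic_matrix_def stochastic_vector_def sum_distrib_left[symmetric] mult.commute)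
  finally show ?thesis .
qed

lemma absolute_probability_sequence_unique:
  fixes S :: "nat \<Rightarrow> real^'n^'n"
  assumes S: "\<And>t. stochastic_matrix (S t)"
    and p: "absolute_probability_sequence S p"
    and q: "absolute_probability_sequence S q"
    and \<eta>: "0 < \<eta>"
    and minor: "\<And>t k i. \<eta> * \<nu> t $ i \<le> window_product S t T $ k $ i"
    and \<nu>: "\<And>t. (\<Sum>i\<in>UNIV. \<nu> t $ i) = 1"
  shows "p = q"
proof -
  define d where "d t = (\<Sum>i\<in>UNIV. \<bar>(p t - q t) $ i\<bar>)" for t
  have stoch: "stochastic_vector (p t)" "stochastic_vector (q t)" for t
    using p q unfolding absolute_probability_sequence_def by blast+
  have P: "stochastic_matrix (window_product S t m)" for t m
    using S by (rule stochastic_window_product)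
  \<comment> \<open>Summing the minorization over a row compares \<open>\<eta>\<close> with the row sum.\<close>
  have "\<eta> * (\<Sum>i\<in>UNIV. \<nu> 0 $ i) \<le> (\<Sum>i\<in>UNIV. window_product S 0 T $ k $ i)" for k
    unfolding sum_distrib_left by (intro sum_mono minor)
  then have \<eta>_le: "\<eta> \<le> 1"
    using P by (simp add: \<nu> stochastic_matrix_def stochastic_vector_def)
  have step: "d t \<le> (1 - \<eta>) * d (t + T)" for t
  proof -
    have "(p (t + T) - q (t + T)) v* window_product S t T = p t - q t"
      using absolute_probability_sequence_window[OF p, of t T]
        absolute_probability_sequence_window[OF q, of t T]
      by (simp add: vector_matrix_mult_diff_distrib)
    moreover have "(\<Sum>k\<in>UNIV. (p (t + T) - q (t + T)) $ k) = 0"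
      using stoch by (simp add: sum_subtractf stochastic_vector_def)
    ultimately show ?thesis
      using l1_norm_contraction[OF P minor \<nu>] unfolding d_def by metis
  qed
  have bound: "d t \<le> 2" for t
  proof -
    have "d t \<le> (\<Sum>i\<in>UNIV. p t $ i + q t $ i)"
      unfolding d_def
    proof (rule sum_mono)
      fix i
      have "0 \<le> p t $ i" "0 \<le> q t $ i"
        using stoch by (simp_all add: stochastic_vector_def)
      then show "\<bar>(p t - q t) $ i\<bar> \<le> p t $ i + q t $ i"
        by simp
    qed
    also have "\<dots> = 2"
      using stoch by (simp add: sum.distrib stochastic_vector_def)
    finally show ?thesis .
  qed
  have iterate: "d t \<le> (1 - \<eta>) ^ m * 2" for m t
  proof (induction m arbitrary: t)
    case 0
    then show ?case using bound by simp
  next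
    case (Suc m)
    have "d t \<le> (1 - \<eta>) * d (t + T)" by (rule step)
    also have "\<dots> \<le> (1 - \<eta>) * ((1 - \<eta>) ^ m * 2)"
      using Suc \<eta>_le by (intro mult_left_mono) auto
    finally show ?case by simp
  qed
  have "d t \<le> 0" for t
  proof -
    have "(\<lambda>m. (1 - \<eta>) ^ m * 2) \<longlonglongrightarrow> 0 * 2"
      using \<eta> \<eta>_le by (intro tendsto_intros LIMSEQ_realpow_zero) auto
    then have "(\<lambda>m. (1 - \<eta>) ^ m * 2) \<longlonglongrightarrow> 0" by simp
    then show ?thesis
      by (rule LIMSEQ_le_const) (use iterate in blast)
  qed
  then have "d t = 0" for t
    by (simp add: d_def antisym sum_nonneg)
  then have "(p t - q t) $ i = 0" for t i
    by (simp add: d_def sum_nonneg_eq_0_iff del: vector_minus_component)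
  then show ?thesis
    by (simp add: fun_eq_iff vec_eq_iff)
qed

section \<open>Vertices reached along time-respecting paths\<close>

primrec reached :: "(nat \<Rightarrow> 'a pair_pre_digraph) \<Rightarrow> nat \<Rightarrow> 'a \<Rightarrow> nat \<Rightarrow> 'a set" where
  "reached \<G> t i 0 = {i}"
| "reached \<G> t i (Suc m) = (\<Union>j\<in>reached \<G> t i m. out_neighbors (\<G> (t + m)) j)"

lemma reached_mono:
  assumes "\<And>t i. (i, i) \<in> parcs (\<G> t)" and "m \<le> m'"
  shows "reached \<G> t i m \<subseteq> reached \<G> t i m'"
proof (rule lift_Suc_mono_le[OF _ assms(2)])
  show "reached \<G> t i m \<subseteq> reached \<G> t i (Suc m)" for m
    using assms(1) by (auto simp: out_neighbors_def)
qed

text \<open>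
  A proper nonempty set of vertices that no arc leaves would not let the vertices inside reach those
  outside.
\<close>

lemma strongly_connected_leaving_arc:
  assumes "strongly_connected G" and "verts G = UNIV" and "R \<noteq> {}" and "R \<noteq> UNIV"
  obtains j k where "(j, k) \<in> arcs_ends G" and "j \<in> R" and "k \<notin> R"
proof -
  obtain u v where uv: "u \<in> R" "v \<notin> R" using assms(3,4) by auto
  have "(u, v) \<in> rtrancl_on (verts G) (arcs_ends G)"
    using assms(1,2) by (auto simp: strongly_connected_def reachable_def)
  then have "\<exists>j k. (j, k) \<in> arcs_ends G \<and> j \<in> R \<and> k \<notin> R"
    using uv(2)
  proof (induction rule: rtrancl_on_induct)
    case base
    then show ?case using uv(1) by blast
  next
    case (step y z)
    then show ?case by blast
  qed
  then show thesis using that by blast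
qed

lemma reached_grows:
  fixes \<G> :: "nat \<Rightarrow> 'n::finite pair_pre_digraph"
  assumes vertices: "\<And>t. pverts (\<G> t) = UNIV"
    and self_arcs: "\<And>t i. (i, i) \<in> parcs (\<G> t)"
    and L: "0 < L"
    and conn: "\<And>t. strongly_connected
        (pre_digraph.Union (with_proj (\<G> t)) ((\<lambda>k. with_proj (\<G> k)) ` {t..t + L - 1}))"
    and proper: "reached \<G> t i m \<noteq> UNIV"
  shows "reached \<G> t i m \<subset> reached \<G> t i (m + L)"
proof -
  note mono = reached_mono[of \<G>, OF self_arcs]
  let ?R = "reached \<G> t i m"
  let ?U = "pre_digraph.Union (with_proj (\<G> (t + m))) ((\<lambda>k. with_proj (\<G> k)) ` {t + m..t + m + L - 1})"
  have "verts ?U = UNIV"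
    using L by (auto simp: pre_digraph.Union_def vertices)
  moreover have "i \<in> ?R"
    using mono[of 0 m t i] by simp
  ultimately obtain j k where jk: "(j, k) \<in> arcs_ends ?U" "j \<in> ?R" "k \<notin> ?R"
    using strongly_connected_leaving_arc[OF conn, of "t + m" ?R] proper by blast
  then obtain s where s: "s \<in> {t + m..t + m + L - 1}" "(j, k) \<in> parcs (\<G> s)"
    by (auto simp: pre_digraph.Union_def arcs_ends_def arc_to_ends_def)
  \<comment> \<open>The set still contains \<open>j\<close> at time \<open>s\<close>, when the arc to \<open>k\<close> is present.\<close>
  define l where "l = s - t"
  have l: "m \<le> l" "Suc l \<le> m + L" "t + l = s" using s(1) L by (auto simp: l_def)
  have "j \<in> reached \<G> t i l"
    using jk(2) mono[OF l(1)] by blast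
  then have "k \<in> reached \<G> t i (Suc l)"
    using s(2) l(3) by (auto simp: out_neighbors_def)
  then have "k \<in> reached \<G> t i (m + L)"
    using mono[OF l(2)] by blast
  then show ?thesis
    using jk(3) mono[of m "m + L"] by auto
qed

lemma reached_eq_UNIV:
  fixes \<G> :: "nat \<Rightarrow> 'n::finite pair_pre_digraph"
  assumes vertices: "\<And>t. pverts (\<G> t) = UNIV"
    and self_arcs: "\<And>t i. (i, i) \<in> parcs (\<G> t)"
    and L: "0 < L"
    and conn: "\<And>t. strongly_connected
        (pre_digraph.Union (with_proj (\<G> t)) ((\<lambda>k. with_proj (\<G> k)) ` {t..t + L - 1}))"
  shows "reached \<G> t i (L * CARD('n)) = UNIV"
proof -
  have "reached \<G> t i (L * c) = UNIV \<or> c < card (reached \<G> t i (L * c))" for c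
  proof (induction c)
    case 0
    then show ?case by simp
  next
    case (Suc c)
    have next_window: "L * Suc c = L * c + L" by simp
    show ?case
    proof (cases "reached \<G> t i (L * c) = UNIV")
      case True
      then have "reached \<G> t i (L * Suc c) = UNIV"
        using reached_mono[of \<G> "L * c" "L * Suc c" t i, OF self_arcs] by auto
      then show ?thesis ..
    next
      case False
      then have "card (reached \<G> t i (L * c)) < card (reached \<G> t i (L * Suc c))"
        unfolding next_window
        by (intro psubset_card_mono reached_grows vertices self_arcs L conn) auto
      then show ?thesis using Suc False by simp
    qed
  qed
  then show ?thesis
    using card_mono[OF finite_class.finite_UNIV subset_UNIV, of "reached \<G> t i (L * CARD('n))"]
    by (metis leD)
qed

section \<open>Push-sum weights and matrices\<close>

text \<open>
  Each factor of a path product is at least \<open>\<beta>\<close> times a quotient of consecutive weights along the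
  path, and these quotients telescope.
\<close>

lemma window_product_ge:
  fixes W :: "nat \<Rightarrow> real^'n^'n"
  assumes nonneg: "\<And>t i j. 0 \<le> W t $ i $ j"
    and weight_ge: "\<And>t i j. j \<in> in_neighbors (\<G> t) i \<Longrightarrow> \<beta> \<le> W t $ i $ j"
    and \<beta>: "0 < \<beta>"
    and pos: "\<And>t i. 0 < push_sum_weight W t $ i"
    and "k \<in> reached \<G> t i m"
  shows "\<beta> ^ m * push_sum_weight W t $ i / push_sum_weight W (t + m) $ k
    \<le> window_product (push_sum_matrix W) t m $ k $ i"
  using assms(5)
proof (induction m arbitrary: k)
  case 0
  then show ?case using pos[of t i] by (simp add: mat_def)
next
  case (Suc m)
  let ?y = "push_sum_weight W" and ?S = "push_sum_matrix W"
  let ?P = "window_product ?S t"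
  obtain j where j: "j \<in> reached \<G> t i m" "j \<in> in_neighbors (\<G> (t + m)) k"
    using Suc.prems by (auto simp: out_neighbors_def in_neighbors_def)
  have S_nonneg: "0 \<le> ?S s $ a $ b" for s a b
    using nonneg pos by (simp add: push_sum_matrix_def less_imp_le del: push_sum_weight.simps)
  have P_nonneg: "0 \<le> ?P l $ a $ b" for l a b
    by (induction l arbitrary: a)
      (auto simp: mat_def matrix_matrix_mult_def S_nonneg intro!: sum_nonneg)
  have "\<beta> ^ Suc m * ?y t $ i / ?y (t + Suc m) $ k
      = (\<beta> * ?y (t + m) $ j / ?y (t + Suc m) $ k) * (\<beta> ^ m * ?y t $ i / ?y (t + m) $ j)"
    using pos[of "t + m" j] by (simp del: push_sum_weight.simps)
  also have "\<dots> \<le> ?S (t + m) $ k $ j * ?P m $ j $ i"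
  proof (rule mult_mono)
    show "\<beta> * ?y (t + m) $ j / ?y (t + Suc m) $ k \<le> ?S (t + m) $ k $ j"
      using weight_ge[OF j(2)] pos[of "t + m" j] pos[of "Suc (t + m)" k]
      by (simp add: push_sum_matrix_def divide_right_mono del: push_sum_weight.simps)
    show "0 \<le> \<beta> ^ m * ?y t $ i / ?y (t + m) $ j"
      using \<beta> pos[of t i] pos[of "t + m" j] by simp
  qed (use Suc.IH[OF j(1)] S_nonneg in auto)
  also have "\<dots> \<le> (\<Sum>b\<in>UNIV. ?S (t + m) $ k $ b * ?P m $ b $ i)"
    by (rule member_le_sum) (auto simp: S_nonneg P_nonneg)
  also have "\<dots> = ?P (Suc m) $ k $ i"
    by (simp add: matrix_matrix_mult_def)
  finally show ?case .
qed

lemma sum_push_sum_weight: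
  fixes W :: "nat \<Rightarrow> real^'n^'n"
  assumes "\<And>t i. (\<Sum>j\<in>UNIV. W t $ j $ i) = 1"
  shows "(\<Sum>i\<in>UNIV. push_sum_weight W t $ i) = real CARD('n)"
proof (induction t)
  case 0
  then show ?case by simp
next
  case (Suc t)
  have "(\<Sum>i\<in>UNIV. push_sum_weight W (Suc t) $ i)
      = (\<Sum>j\<in>UNIV. \<Sum>i\<in>UNIV. W t $ i $ j * push_sum_weight W t $ j)"
    by (simp add: sum.swap[of "\<lambda>i j. W t $ i $ j * push_sum_weight W t $ j"])
  also have "\<dots> = (\<Sum>j\<in>UNIV. push_sum_weight W t $ j)"
    by (simp add: sum_distrib_right[symmetric] assms)
  finally show ?case using Suc by simp
qed

lemma absolute_probability_sequence_push_sum: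
  fixes W :: "nat \<Rightarrow> real^'n^'n"
  assumes col: "\<And>t i. (\<Sum>j\<in>UNIV. W t $ j $ i) = 1"
    and pos: "\<And>t i. 0 < push_sum_weight W t $ i"
  shows "absolute_probability_sequence (push_sum_matrix W)
      (\<lambda>t. \<chi> i. push_sum_weight W t $ i / real CARD('n))"
  unfolding absolute_probability_sequence_def stochastic_vector_def
proof (intro conjI allI)
  let ?y = "push_sum_weight W"
  show "0 \<le> (\<chi> i. ?y t $ i / real CARD('n)) $ i" for t i
    using pos[of t i] by simp
  show "(\<Sum>i\<in>UNIV. (\<chi> i. ?y t $ i / real CARD('n)) $ i) = 1" for t
    using sum_push_sum_weight[of W t, OF col] by (simp add: sum_divide_distrib[symmetric])
  show "(\<chi> i. ?y t $ i / real CARD('n))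
      = (\<chi> i. ?y (Suc t) $ i / real CARD('n)) v* push_sum_matrix W t" for t
  proof (rule vec_eq_iff[THEN iffD2], rule allI)
    fix j
    have nonzero: "?y (Suc t) $ i \<noteq> 0" for i
      using pos[of "Suc t" i] by (simp del: push_sum_weight.simps)
    have "((\<chi> i. ?y (Suc t) $ i / real CARD('n)) v* push_sum_matrix W t) $ j
        = (\<Sum>i\<in>UNIV. W t $ i $ j * (?y t $ j / real CARD('n)))"
      by (simp add: vector_matrix_mult_def push_sum_matrix_def nonzero del: push_sum_weight.simps)
    also have "\<dots> = ?y t $ j / real CARD('n)"
      unfolding sum_distrib_right[symmetric] by (simp add: col)
    finally show "(\<chi> i. ?y t $ i / real CARD('n)) $ j
        = ((\<chi> i. ?y (Suc t) $ i / real CARD('n)) v* push_sum_matrix W t) $ j"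
      by simp
  qed
qed

theorem proposition2:
  fixes \<G> :: "nat \<Rightarrow> 'n::finite pair_pre_digraph"
    and W :: "nat \<Rightarrow> real^'n^'n"
    and \<beta> :: real
  assumes vertices: "\<And>t. pverts (\<G> t) = UNIV"
    and self_arcs: "\<And>t i. (i, i) \<in> parcs (\<G> t)"
    and beta_pos: "0 < \<beta>"
    and weight_ge: "\<And>t i j. j \<in> in_neighbors (\<G> t) i \<Longrightarrow> \<beta> \<le> W t $ i $ j"
    and weight_zero: "\<And>t i j. j \<notin> in_neighbors (\<G> t) i \<Longrightarrow> W t $ i $ j = 0"
    and column_sum: "\<And>t i. (\<Sum>j\<in>out_neighbors (\<G> t) i. W t $ j $ i) = 1"
    and connected: "uniformly_strongly_connected \<G>"
  shows "(\<exists>!\<pi>. absolute_probability_sequence (push_sum_matrix W) \<pi>) \<and>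
    absolute_probability_sequence (push_sum_matrix W)
      (\<lambda>t. \<chi> i. push_sum_weight W t $ i / real CARD('n))"
proof -
  let ?y = "push_sum_weight W" and ?n = "real CARD('n)"
  let ?\<pi> = "\<lambda>t. \<chi> i. ?y t $ i / ?n"
  have nonneg: "0 \<le> W t $ i $ j" for t i j
    using weight_ge[of j t i] weight_zero[of j t i] beta_pos by fastforce
  have diag: "0 < W t $ i $ i" for t i
    using weight_ge[of i t i] self_arcs[of i t] beta_pos by (auto simp: in_neighbors_def)
  note pos = push_sum_weight_pos[of W, OF nonneg diag]
  have col: "(\<Sum>j\<in>UNIV. W t $ j $ i) = 1" for t i
  proof -
    have "(\<Sum>j\<in>UNIV. W t $ j $ i) = (\<Sum>j\<in>out_neighbors (\<G> t) i. W t $ j $ i)"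
      by (rule sum.mono_neutral_right)
        (auto simp: out_neighbors_def in_neighbors_def intro!: weight_zero)
    then show ?thesis by (simp add: column_sum)
  qed
  note total = sum_push_sum_weight[of W, OF col]
  have y_le: "?y t $ i \<le> ?n" for t i
    unfolding total[of t, symmetric]
    by (rule member_le_sum) (auto simp: less_imp_le[OF pos])
  have stoch: "stochastic_matrix (push_sum_matrix W t)" for t
    using self_arcs beta_pos weight_ge weight_zero by (rule stochastic_push_sum_matrix)
  have \<pi>: "absolute_probability_sequence (push_sum_matrix W) ?\<pi>"
    using col pos by (rule absolute_probability_sequence_push_sum)
  obtain L where L: "0 < L" and conn: "\<And>t. strongly_connected
      (pre_digraph.Union (with_proj (\<G> t)) ((\<lambda>k. with_proj (\<G> k)) ` {t..t + L - 1}))"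
    using connected unfolding uniformly_strongly_connected_def by blast
  define T where "T = L * CARD('n)"
  have minor: "\<beta> ^ T * ?\<pi> t $ i \<le> window_product (push_sum_matrix W) t T $ k $ i" for t k i
  proof -
    have "k \<in> reached \<G> t i T"
      unfolding T_def using reached_eq_UNIV[OF vertices self_arcs L conn] by blast
    then have "\<beta> ^ T * ?y t $ i / ?y (t + T) $ k \<le> window_product (push_sum_matrix W) t T $ k $ i"
      by (intro window_product_ge nonneg beta_pos pos weight_ge)
    moreover have "\<beta> ^ T * ?y t $ i / ?n \<le> \<beta> ^ T * ?y t $ i / ?y (t + T) $ k"
      using y_le[of "t + T" k] pos[of "t + T" k] pos[of t i] beta_pos
      by (intro divide_left_mono) auto
    ultimately show ?thesis by simp
  qed
  have "q = ?\<pi>" if "absolute_probability_sequence (push_sum_matrix W) q" for q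
  proof (rule absolute_probability_sequence_unique[OF stoch that \<pi> _ minor])
    show "0 < \<beta> ^ T" using beta_pos by simp
    show "(\<Sum>i\<in>UNIV. ?\<pi> t $ i) = 1" for t
      using \<pi> unfolding absolute_probability_sequence_def stochastic_vector_def by blast
  qed
  then show ?thesis using \<pi> by blast
qed

end
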